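(* (Disjunctive syllogism.) For all formulas $A,B$: if $A\lor B\in\mathcal{L}_4$ and ${\sim}A\in\mathcal{L}_4$ then $B\in\mathcal{L}_4$.
   Context: Formulas are built from a countable set of propositional variables using the binary connectives $\lor,\land,\to$ and the unary connective $\sim$. An assertion $A_{ij}$ is a formula $A$ together with an ordered pair of indices $i,j\in\{0,1,2,3\}$. A sequent $\Gamma\Rightarrow\Delta$ is an ordered pair of sets of assertions; commas denote union, and either side may be empty. A 4-proof is a finite sequence of sequents each of which is an Axiom or follows from one or two earlier sequents by a rule below ($\Gamma,\Gamma',\Delta,\Delta'$ are arbitrary sets of assertions, $i,j,k\in\{0,1,2,3\}$): - Axiom: $\Gamma\Rightarrow\Delta$ whenever $\Gamma\cap\Delta\neq\emptyset$. - Cut: from $\Gamma\Rightarrow\Delta,A_{ij}$ and $A_{ij},\Gamma'\Rightarrow\Delta'$ infer $\Gamma,\Gamma'\Rightarrow\Delta,\Delta'$. - Weakening: from $\Gamma\Rightarrow\Delta$ infer $\Gamma,\Gamma'\Rightarrow\Delta,\Delta'$. - $\lor|$: from $\Gamma,A_{ij}\Rightarrow\Delta$ and $\Gamma',B_{ij}\Rightarrow\Delta'$ infer $\Gamma,\Gamma',(A\lor B)_{ij}\Rightarrow\Delta,\Delta'$. - $|\lor$: from $\Gamma\Rightarrow\Delta,A_{ij},B_{ij}$ infer $\Gamma\Rightarrow\Delta,(A\lor B)_{ij}$. - $\land|$: from $\Gamma,A_{ij},B_{ij}\Rightarrow\Delta$ infer $\Gamma,(A\land B)_{ij}\Rightarrow\Delta$.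 - $|\land$: from $\Gamma\Rightarrow\Delta,A_{ij}$ and $\Gamma'\Rightarrow\Delta',B_{ij}$ infer $\Gamma,\Gamma'\Rightarrow\Delta,\Delta',(A\land B)_{ij}$. - ${\sim}|$: from $\Gamma\Rightarrow\Delta,A_{ij}$ infer $\Gamma,({\sim}A)_{ji}\Rightarrow\Delta$. - $|{\sim}$: from $\Gamma,A_{ij}\Rightarrow\Delta$ infer $\Gamma\Rightarrow\Delta,({\sim}A)_{ji}$. - ${\to}|$: from $\Gamma\Rightarrow\Delta,A_{ki}$ and $\Gamma',B_{kj}\Rightarrow\Delta'$ infer $\Gamma,\Gamma',(A\to B)_{ij}\Rightarrow\Delta,\Delta'$. - $|{\to}$: from $\Gamma,A_{ki}\Rightarrow\Delta,B_{kj}$ infer $\Gamma\Rightarrow\Delta,(A\to B)_{ij}$, provided $k\neq i,j$ and $k$ does not occur as a subscript in any assertion of $\Gamma\cup\Delta$. Tarski's relevance logic $\mathcal{L}_4$ is the set of formulas $A$ such that the sequent $\Rightarrow A_{00}$ appears in some 4-proof. *)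

theory Defs
  imports Main "HOL-Library.Countable" "HOL-Library.Numeral_Type"
begin

datatype 'v fm =
    Var 'v
  | Or "'v fm" "'v fm"
  | And "'v fm" "'v fm"
  | Imp "'v fm" "'v fm"
  | Neg "'v fm"

text \<open>The numeral type \<open>4\<close> serves as the index set with the elements 0, 1, 2, 3; only
  equality of indices is used, never the arithmetic modulo 4.\<close>

type_synonym idx = 4

datatype 'v assertion = Asrt (asrt_fm: "'v fm") (asrt_left: idx) (asrt_right: idx)

text \<open>The sides of a sequent are arbitrary, possibly infinite, sets of assertions.\<close>

type_synonym 'v sequent = "'v assertion set \<times> 'v assertion set"

definition subscripts :: "'v assertion set \<Rightarrow> idx set" where
  "subscripts X = (\<Union>a\<in>X. {asrt_left a, asrt_right a})"

definition is_axiom :: "'v sequent \<Rightarrow> bool" where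
  "is_axiom s \<longleftrightarrow> fst s \<inter> snd s \<noteq> {}"

text \<open>\<open>infers ps s\<close>: the sequent \<open>s\<close> results from the list of premises \<open>ps\<close> by a single
  application of a rule. The contexts are not required to be disjoint from the displayed
  assertions, so contraction is implicit.\<close>

inductive infers :: "'v sequent list \<Rightarrow> 'v sequent \<Rightarrow> bool" where
  Cut: "infers [(\<Gamma>, \<Delta> \<union> {Asrt A i j}), ({Asrt A i j} \<union> \<Gamma>', \<Delta>')] (\<Gamma> \<union> \<Gamma>', \<Delta> \<union> \<Delta>')"
| Weakening: "infers [(\<Gamma>, \<Delta>)] (\<Gamma> \<union> \<Gamma>', \<Delta> \<union> \<Delta>')"
| OrL: "infers [(\<Gamma> \<union> {Asrt A i j}, \<Delta>), (\<Gamma>' \<union> {Asrt B i j}, \<Delta>')]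
    (\<Gamma> \<union> \<Gamma>' \<union> {Asrt (Or A B) i j}, \<Delta> \<union> \<Delta>')"
| OrR: "infers [(\<Gamma>, \<Delta> \<union> {Asrt A i j, Asrt B i j})] (\<Gamma>, \<Delta> \<union> {Asrt (Or A B) i j})"
| AndL: "infers [(\<Gamma> \<union> {Asrt A i j, Asrt B i j}, \<Delta>)] (\<Gamma> \<union> {Asrt (And A B) i j}, \<Delta>)"
| AndR: "infers [(\<Gamma>, \<Delta> \<union> {Asrt A i j}), (\<Gamma>', \<Delta>' \<union> {Asrt B i j})]
    (\<Gamma> \<union> \<Gamma>', \<Delta> \<union> \<Delta>' \<union> {Asrt (And A B) i j})"
| NegL: "infers [(\<Gamma>, \<Delta> \<union> {Asrt A i j})] (\<Gamma> \<union> {Asrt (Neg A) j i}, \<Delta>)"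
| NegR: "infers [(\<Gamma> \<union> {Asrt A i j}, \<Delta>)] (\<Gamma>, \<Delta> \<union> {Asrt (Neg A) j i})"
| ImpL: "infers [(\<Gamma>, \<Delta> \<union> {Asrt A k i}), (\<Gamma>' \<union> {Asrt B k j}, \<Delta>')]
    (\<Gamma> \<union> \<Gamma>' \<union> {Asrt (Imp A B) i j}, \<Delta> \<union> \<Delta>')"
| ImpR: "infers [(\<Gamma> \<union> {Asrt A k i}, \<Delta> \<union> {Asrt B k j})] (\<Gamma>, \<Delta> \<union> {Asrt (Imp A B) i j})"
    if "k \<noteq> i" and "k \<noteq> j" and "k \<notin> subscripts (\<Gamma> \<union> \<Delta>)"

definition four_proof :: "'v sequent list \<Rightarrow> bool" where
  "four_proof S \<longleftrightarrow>
    (\<forall>n<length S. is_axiom (S ! n) \<or> (\<exists>ps. set ps \<subseteq> set (take n S) \<and> infers ps (S ! n)))"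

definition L4 :: "'v fm set" where
  "L4 = {A. \<exists>S. four_proof S \<and> ({}, {Asrt A 0 0}) \<in> set S}"

end

theory Submission
  imports Defs
begin

text \<open>With Cut among the rules, the classical derivation of the disjunctive syllogism goes
  through: the left rule for negation refutes \<open>A\<^sub>0\<^sub>0\<close> from \<open>(\<sim>A)\<^sub>0\<^sub>0\<close>, the left rule for disjunction
  splits \<open>(A \<or> B)\<^sub>0\<^sub>0\<close> into \<open>A\<^sub>0\<^sub>0, B\<^sub>0\<^sub>0\<close> on the right, and three cuts discharge the
  two hypotheses and then \<open>A\<^sub>0\<^sub>0\<close>. The negation rules transpose the indices, so
  this works because \<open>00\<close> is its own transpose. As concatenations of 4-proofs are 4-proofs, such
  derivations can be composed rule by rule instead of as explicit sequences
  (\<open>derivable_infers\<close>).\<close>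

definition derivable :: "'v sequent \<Rightarrow> bool" where
  "derivable s \<longleftrightarrow> (\<exists>S. four_proof S \<and> s \<in> set S)"

lemma L4_iff_derivable: "A \<in> L4 \<longleftrightarrow> derivable ({}, {Asrt A 0 0})"
  by (simp add: L4_def derivable_def)

lemma four_proof_append:
  assumes "four_proof S" and "four_proof T"
  shows "four_proof (S @ T)"
  unfolding four_proof_def
proof (intro allI impI)
  fix n
  assume n: "n < length (S @ T)"
  show "is_axiom ((S @ T) ! n) \<or>
    (\<exists>ps. set ps \<subseteq> set (take n (S @ T)) \<and> infers ps ((S @ T) ! n))"
  proof (cases "n < length S")
    case True
    then show ?thesis
      using assms(1) by (simp add: four_proof_def nth_append)
  next
    case False
    define m where "m = n - length S"
    have m: "m < length T" "(S @ T) ! n = T ! m" "take n (S @ T) = S @ take m T"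
      using n False by (auto simp: m_def nth_append)
    have "is_axiom (T ! m) \<or> (\<exists>ps. set ps \<subseteq> set (take m T) \<and> infers ps (T ! m))"
      using assms(2) m(1) by (simp add: four_proof_def)
    then show ?thesis
      unfolding m(2,3) by auto
  qed
qed

lemma four_proof_snoc:
  assumes "four_proof S"
    and "is_axiom s \<or> (\<exists>ps. set ps \<subseteq> set S \<and> infers ps s)"
  shows "four_proof (S @ [s])"
  using assms by (auto simp: four_proof_def nth_append less_Suc_eq)

lemma four_proof_collect:
  assumes "\<forall>p\<in>set ps. derivable p"
  shows "\<exists>S. four_proof S \<and> set ps \<subseteq> set S"
  using assms
proof (induction ps)
  case Nil
  have "four_proof []"
    by (simp add: four_proof_def)
  then show ?case
    by auto
next
  case (Cons p ps)
  then obtain S T where "four_proof S" "set ps \<subseteq> set S" "four_proof T" "p \<in> set T"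
    by (auto simp: derivable_def)
  then have "four_proof (S @ T)" "set (p # ps) \<subseteq> set (S @ T)"
    by (auto intro: four_proof_append)
  then show ?case
    by blast
qed

lemma derivable_infers:
  assumes "infers ps s" and "\<forall>p\<in>set ps. derivable p"
  shows "derivable s"
proof -
  obtain S where "four_proof S" "set ps \<subseteq> set S"
    using four_proof_collect[OF assms(2)] by blast
  then have "four_proof (S @ [s])"
    using assms(1) by (blast intro: four_proof_snoc)
  then show ?thesis
    unfolding derivable_def by (metis in_set_conv_decomp)
qed

lemma derivable_refl: "derivable ({a}, {a})"
proof -
  have "four_proof [({a}, {a})]"
    by (simp add: four_proof_def is_axiom_def)
  then show ?thesis
    unfolding derivable_def by (metis list.set_intros(1))
qed

lemma derivable_cut:
  assumes "derivable ({}, \<Delta> \<union> {Asrt A i j})" and "derivable ({Asrt A i j}, \<Delta>')"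
  shows "derivable ({}, \<Delta> \<union> \<Delta>')"
  using derivable_infers[OF infers.Cut[of "{}" \<Delta> A i j "{}" \<Delta>']] assms by simp

text \<open>Cutting against the instance \<open>(\<sim>A)\<^sub>j\<^sub>i, A\<^sub>i\<^sub>j \<Rightarrow>\<close> of the left rule for negation inverts the
  right rule.\<close>

lemma derivable_NegR_inverse:
  assumes "derivable ({}, {Asrt (Neg A) j i})"
  shows "derivable ({Asrt A i j}, {})"
proof -
  have "derivable ({Asrt A i j} \<union> {Asrt (Neg A) j i}, {})"
    using derivable_infers[OF infers.NegL[of "{Asrt A i j}" "{}" A i j]]
    by (simp add: derivable_refl insert_commute)
  then have "derivable ({Asrt (Neg A) j i} \<union> {Asrt A i j}, {})"
    by (simp add: insert_commute)
  then show ?thesis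
    using derivable_infers[OF infers.Cut[of "{}" "{}" "Neg A" j i "{Asrt A i j}" "{}"]] assms
    by simp
qed

text \<open>Cutting against \<open>(A \<or> B)\<^sub>i\<^sub>j \<Rightarrow> A\<^sub>i\<^sub>j, B\<^sub>i\<^sub>j\<close> likewise inverts the right rule for
  disjunction.\<close>

lemma derivable_OrR_inverse:
  assumes "derivable ({}, {Asrt (Or A B) i j})"
  shows "derivable ({}, {Asrt A i j, Asrt B i j})"
proof -
  have "derivable ({Asrt (Or A B) i j}, {Asrt A i j, Asrt B i j})"
    using derivable_infers[OF infers.OrL[of "{}" A i j "{Asrt A i j}" "{}" B "{Asrt B i j}"]]
    by (simp add: derivable_refl insert_commute)
  then show ?thesis
    using derivable_cut[of "{}" "Or A B" i j] assms by simp
qed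

theorem lemma41:
  fixes A B :: "'v::countable fm"
  assumes "Or A B \<in> L4" and "Neg A \<in> L4"
  shows "B \<in> L4"
proof -
  have "derivable ({}, {Asrt B 0 0} \<union> {Asrt A 0 0})"
    using assms(1) derivable_OrR_inverse[of A B 0 0]
    by (simp add: L4_iff_derivable insert_commute)
  moreover have "derivable ({Asrt A 0 0}, {})"
    using assms(2) by (simp add: L4_iff_derivable derivable_NegR_inverse)
  ultimately have "derivable ({}, {Asrt B 0 0} \<union> {})"
    by (rule derivable_cut)
  then show ?thesis
    by (simp add: L4_iff_derivable)
qed

end
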